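(* Let $G$ be any directed acyclic graph on $n$ nodes and $m$ edges with the intermediate property. Then the diameter of the graph of the singly-capacitated network flow polytope $P$ on $G$ with any supply vector $b$ is no more than $2m$.
   Context: A directed acyclic graph on nodes $\{1,\dots,n\}$ has the intermediate property if: (i) there is an edge from $i+1$ to $i$ for all $i=1,\dots,n-1$; (ii) for each $i$, node $i$ is a sink of the graph $G\setminus\{1,\dots,i-1\}$; (iii) for $j>i$, if there is an edge from $j$ to $i-1$ in $G$, then there is an edge from $j$ to $i$. For $b:\{1,\dots,n\}\to\mathbb{R}$, the singly-capacitated network flow polytope is the set of $x=(x_{i,j})_{(i,j)\text{ edge}}$ with $x_{i,j}\ge0$ and $\sum_{\{j:(i,j)\text{ edge}\}}x_{i,j}-\sum_{\{j:(j,i)\text{ edge}\}}x_{j,i}=b(i)$ for every node $i$. The diameter of a polytope is the diameter of its graph. *)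

theory Defs
  imports
    "HOL-Analysis.Polytope"
    "HOL-Analysis.Finite_Function_Topology"
    "HOL-Library.Extended_Nat"
begin

text \<open>A directed graph on the nodes \<open>{1..n}\<close> is given by its edge relation;
  \<open>(i, j) \<in> E\<close> is an edge from \<open>i\<close> to \<open>j\<close>.\<close>

definition dag_on :: "nat \<Rightarrow> (nat \<times> nat) set \<Rightarrow> bool" where
  "dag_on n E \<longleftrightarrow> E \<subseteq> {1..n} \<times> {1..n} \<and> acyclic E"

definition remove_nodes :: "(nat \<times> nat) set \<Rightarrow> nat set \<Rightarrow> (nat \<times> nat) set" where
  "remove_nodes E S = {(i, j) \<in> E. i \<notin> S \<and> j \<notin> S}"

definition is_sink :: "(nat \<times> nat) set \<Rightarrow> nat \<Rightarrow> bool" where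
  "is_sink E i \<longleftrightarrow> (\<forall>j. (i, j) \<notin> E)"

text \<open>In the last condition the case \<open>i = 1\<close> is vacuous, since \<open>0\<close> is not a node.\<close>

definition intermediate_property :: "nat \<Rightarrow> (nat \<times> nat) set \<Rightarrow> bool" where
  "intermediate_property n E \<longleftrightarrow>
     (\<forall>i\<in>{1..<n}. (i + 1, i) \<in> E) \<and>
     (\<forall>i\<in>{1..n}. is_sink (remove_nodes E {1..<i}) i) \<and>
     (\<forall>i\<in>{1..n}. \<forall>j\<in>{1..n}. i < j \<longrightarrow> (j, i - 1) \<in> E \<longrightarrow> (j, i) \<in> E)"

text \<open>The space \<open>\<real>\<^sup>E\<close> is rendered as the finitely supported functions on pairs of nodes
  whose support lies in \<open>E\<close>.\<close>

definition flow_polytope ::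
    "nat \<Rightarrow> (nat \<times> nat) set \<Rightarrow> (nat \<Rightarrow> real) \<Rightarrow> ((nat \<times> nat) \<Rightarrow>\<^sub>0 real) set" where
  "flow_polytope n E b =
     {x. Poly_Mapping.keys x \<subseteq> E \<and>
         (\<forall>e\<in>E. 0 \<le> Poly_Mapping.lookup x e) \<and>
         (\<forall>i\<in>{1..n}. (\<Sum>j | (i, j) \<in> E. Poly_Mapping.lookup x (i, j))
                    - (\<Sum>j | (j, i) \<in> E. Poly_Mapping.lookup x (j, i)) = b i)}"

definition polytope_vertices :: "'a::real_vector set \<Rightarrow> 'a set" where
  "polytope_vertices P = {v. v extreme_point_of P}"

text \<open>Vertices \<open>u \<noteq> v\<close> are adjacent when the segment between them is a (necessarily
  one-dimensional) face. The library's \<^const>\<open>edge_of\<close> needs a Euclidean space, which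
  the finitely supported functions are not.\<close>

definition polytope_adjacency :: "'a::real_vector set \<Rightarrow> ('a \<times> 'a) set" where
  "polytope_adjacency P =
     {(u, v). u \<in> polytope_vertices P \<and> v \<in> polytope_vertices P \<and> u \<noteq> v \<and>
              closed_segment u v face_of P}"

text \<open>The distance is \<open>\<infinity>\<close> for nodes not joined by a path; the diameter of the empty
  graph is \<open>0\<close>.\<close>

definition graph_distance :: "('a \<times> 'a) set \<Rightarrow> 'a \<Rightarrow> 'a \<Rightarrow> enat" where
  "graph_distance R u v = (INF k \<in> {k. (u, v) \<in> R ^^ k}. enat k)"

definition graph_diameter :: "'a set \<Rightarrow> ('a \<times> 'a) set \<Rightarrow> enat" where
  "graph_diameter V R = (SUP u\<in>V. SUP v\<in>V. graph_distance R u v)"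

definition polytope_diameter :: "'a::real_vector set \<Rightarrow> enat" where
  "polytope_diameter P = graph_diameter (polytope_vertices P) (polytope_adjacency P)"

end

(*
  Every vertex is joined by at most m edges of P to the unique flow that only uses the
  edges (i + 1, i). For i = 1, 2, ... the edges (j, i) with j > i + 1 are emptied in turn,
  which takes at most indegree(i) steps: whenever (j, i) carries flow, one either pivots the
  edge (i + 1, i) into the support, or this edge does not close a cycle with the support, and
  then the rerouting from (j, i) to (j, i + 1), (i + 1, i), available by the intermediate
  property, is itself a step along an edge of P that empties (j, i).
*)

theory Submission
  imports Defs
begin

abbreviation lookup :: "('a \<Rightarrow>\<^sub>0 'b::zero) \<Rightarrow> 'a \<Rightarrow> 'b" where
  "lookup \<equiv> Poly_Mapping.lookup"

abbreviation keys :: "('a \<Rightarrow>\<^sub>0 'b::zero) \<Rightarrow> 'a set" where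
  "keys \<equiv> Poly_Mapping.keys"

section \<open>Coordinates of scaled functions and reversal of walks\<close>

lemma lookup_scaleR [simp]:
  fixes x :: "'a \<Rightarrow>\<^sub>0 'b::real_vector"
  shows "lookup (r *\<^sub>R x) k = r *\<^sub>R lookup x k"
proof -
  have "finite {i. r *\<^sub>R lookup x i \<noteq> 0}"
    by (rule finite_subset[OF _ finite_keys[of x]]) (auto simp: in_keys_iff)
  then show ?thesis
    by (simp add: scaleR_poly_mapping_def)
qed

lemma keys_step: "keys (x + t *\<^sub>R d) \<subseteq> keys x \<union> keys d"
  for x d :: "'a \<Rightarrow>\<^sub>0 'b::real_vector"
  by (auto simp: in_keys_iff lookup_add)

lemma relpow_sym: "sym R \<Longrightarrow> (u, v) \<in> R ^^ k \<Longrightarrow> (v, u) \<in> R ^^ k"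
  by (induction k arbitrary: v) (auto simp del: relpow.simps(2) elim!: relpow_Suc_E
      intro!: relpow_Suc_I2 dest: symD)

section \<open>Vertices and edges of flow polytopes\<close>

text \<open>The form in which the sink condition is used: every edge runs from a larger to a smaller
  number, so the numbering is a topological order.\<close>

locale descending_graph =
  fixes n :: nat and E :: "(nat \<times> nat) set"
  assumes nodes: "E \<subseteq> {1..n} \<times> {1..n}"
    and descending: "(j, i) \<in> E \<Longrightarrow> i < j"
begin

section \<open>Net flow and circulations\<close>

lemma finite_E: "finite E"
  using nodes finite_subset by blast

text \<open>Product with the incidence matrix, written as one sum over \<open>E\<close>: linearity
  in \<open>x\<close> is then immediate, and \<open>net_eq\<close> recovers outflow minus
  inflow.\<close>

definition net :: "((nat \<times> nat) \<Rightarrow>\<^sub>0 real) \<Rightarrow> nat \<Rightarrow> real" where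
  "net x i = (\<Sum>e\<in>E. lookup x e * (of_bool (fst e = i) - of_bool (snd e = i)))"

lemma net_eq:
  "(\<Sum>j | (i, j) \<in> E. lookup x (i, j)) - (\<Sum>j | (j, i) \<in> E. lookup x (j, i)) = net x i"
proof -
  have "(\<Sum>j | (i, j) \<in> E. lookup x (i, j)) = (\<Sum>e\<in>{e\<in>E. fst e = i}. lookup x e)"
    by (rule sum.reindex_bij_witness[of _ snd "Pair i"]) auto
  moreover have "(\<Sum>j | (j, i) \<in> E. lookup x (j, i)) = (\<Sum>e\<in>{e\<in>E. snd e = i}. lookup x e)"
    by (rule sum.reindex_bij_witness[of _ fst "\<lambda>j. (j, i)"]) auto
  moreover have "(\<Sum>e\<in>E. lookup x e * of_bool (P e)) = (\<Sum>e\<in>{e\<in>E. P e}. lookup x e)" for P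
    by (simp add: of_bool_def if_distrib sum.inter_filter finite_E cong: if_cong)
  ultimately show ?thesis
    by (simp add: net_def right_diff_distrib sum_subtractf)
qed

lemma net_add: "net (x + y) i = net x i + net y i"
  by (simp add: net_def lookup_add distrib_right sum.distrib)

lemma net_diff: "net (x - y) i = net x i - net y i"
  by (simp add: net_def lookup_minus left_diff_distrib sum_subtractf)

lemma net_scaleR: "net (r *\<^sub>R x) i = r * net x i"
  by (simp add: net_def sum_distrib_left mult.assoc)

lemma net_single:
  "e \<in> E \<Longrightarrow> net (Poly_Mapping.single e c) i = c * (of_bool (fst e = i) - of_bool (snd e = i))"
  unfolding net_def
  by (subst sum.remove[OF finite_E, of e])
     (auto simp: lookup_single when_def intro!: sum.neutral split: if_splits)

text \<open>The kernel of the incidence matrix. Signs are free, so that differences of flows with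
  the same supplies belong to it.\<close>

definition circulation :: "((nat \<times> nat) \<Rightarrow>\<^sub>0 real) \<Rightarrow> bool" where
  "circulation z \<longleftrightarrow> keys z \<subseteq> E \<and> (\<forall>i\<in>{1..n}. net z i = 0)"

text \<open>Nonnegativity can be stated at all pairs because \<open>x\<close> vanishes off
  \<open>E\<close>.\<close>

lemma flow_iff:
  "x \<in> flow_polytope n E b \<longleftrightarrow>
     keys x \<subseteq> E \<and> (\<forall>e. 0 \<le> lookup x e) \<and> (\<forall>i\<in>{1..n}. net x i = b i)"
  unfolding flow_polytope_def net_eq
  by (auto simp: subset_iff in_keys_iff) (metis order_refl)

lemma flow_nonneg: "x \<in> flow_polytope n E b \<Longrightarrow> 0 \<le> lookup x e"
  unfolding flow_iff by blast

lemma circulation_diff_flow: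
  assumes "x \<in> flow_polytope n E b" "y \<in> flow_polytope n E b"
  shows "circulation (x - y)"
  using assms keys_diff[of x y] by (auto simp: flow_iff circulation_def net_diff)

lemma circulation_scaleR: "circulation z \<Longrightarrow> circulation (c *\<^sub>R z)"
  by (auto simp: circulation_def net_scaleR in_keys_iff subset_iff)

lemma circulation_diff: "circulation z \<Longrightarrow> circulation w \<Longrightarrow> circulation (z - w)"
  using keys_diff[of z w] by (auto simp: circulation_def net_diff)

text \<open>Weighting node \<open>i\<close> by \<open>i\<close> gives every edge a positive total weight.\<close>

lemma circulation_has_negative:
  assumes "circulation z" "z \<noteq> 0"
  shows "\<exists>e. lookup z e < 0"
proof (rule ccontr)
  assume "\<not> ?thesis"
  then have nonneg: "0 \<le> lookup z e" for e
    by (meson not_less)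
  have "0 = (\<Sum>i\<in>{1..n}. real i * net z i)"
    using assms by (simp add: circulation_def)
  also have "\<dots> = (\<Sum>e\<in>E. \<Sum>i\<in>{1..n}. real i * (lookup z e * (of_bool (fst e = i) - of_bool (snd e = i))))"
    unfolding net_def sum_distrib_left by (rule sum.swap)
  also have "\<dots> = (\<Sum>e\<in>E. lookup z e * (real (fst e) - real (snd e)))"
  proof (rule sum.cong[OF refl])
    fix e assume "e \<in> E"
    then have e: "fst e \<in> {1..n}" "snd e \<in> {1..n}"
      using nodes by auto
    have *: "(\<Sum>i\<in>{1..n}. real i * of_bool (k = i)) = real k" if "k \<in> {1..n}" for k
      using that by (simp add: of_bool_def if_distrib cong: if_cong)
    have "(\<Sum>i\<in>{1..n}. real i * (lookup z e * (of_bool (fst e = i) - of_bool (snd e = i))))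
      = lookup z e * ((\<Sum>i\<in>{1..n}. real i * of_bool (fst e = i)) - (\<Sum>i\<in>{1..n}. real i * of_bool (snd e = i)))"
      unfolding sum_distrib_left right_diff_distrib sum_subtractf by (simp only: mult.left_commute)
    then show "(\<Sum>i\<in>{1..n}. real i * (lookup z e * (of_bool (fst e = i) - of_bool (snd e = i))))
      = lookup z e * (real (fst e) - real (snd e))"
      using *[OF e(1)] *[OF e(2)] by simp
  qed
  finally have "(\<Sum>e\<in>E. lookup z e * (real (fst e) - real (snd e))) = 0"
    by simp
  moreover have "0 < real (fst e) - real (snd e)" if "e \<in> E" for e
    using descending[of "fst e" "snd e"] that by simp
  ultimately have "lookup z e = 0" if "e \<in> E" for e
    using that nonneg sum_nonneg_eq_0_iff[OF finite_E, of "\<lambda>e. lookup z e * (real (fst e) - real (snd e))"]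
    by (smt (verit) mult_eq_0_iff mult_nonneg_nonneg)
  then have "lookup z e = 0" for e
    using assms(1) by (cases "e \<in> E") (auto simp: circulation_def in_keys_iff)
  then show False
    using assms(2) by (simp add: poly_mapping_eqI)
qed

section \<open>The ratio test, vertices and edges\<close>

lemma ratio_step:
  assumes x: "x \<in> flow_polytope n E b"
    and d: "circulation d" "d \<noteq> 0" and pos: "\<And>e. lookup d e < 0 \<Longrightarrow> e \<in> keys x"
  obtains t e where "0 < t" "x + t *\<^sub>R d \<in> flow_polytope n E b"
    "lookup d e < 0" "lookup (x + t *\<^sub>R d) e = 0"
proof -
  define N where "N = {e. lookup d e < 0}"
  define r where "r e = lookup x e / - lookup d e" for e
  have "finite N"
    unfolding N_def by (rule finite_subset[OF _ finite_keys[of d]]) (auto simp: in_keys_iff)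
  moreover have "N \<noteq> {}"
    using circulation_has_negative[OF d] by (simp add: N_def)
  \<comment> \<open>Ratio test of the simplex method: among the coordinates that decrease along
    \<open>d\<close>, \<open>e\<close> is one of the first to reach 0, at step length
    \<open>r e\<close>. There is such a coordinate because edges descend.\<close>
  ultimately obtain e where e: "e \<in> N" and min: "\<And>e'. e' \<in> N \<Longrightarrow> r e \<le> r e'"
    by (metis arg_min_if_finite(1) arg_min_least)
  have xnn: "0 \<le> lookup x e'" for e'
    using x by (rule flow_nonneg)
  have "0 < lookup x e"
    using e pos[of e] xnn[of e] by (simp add: N_def in_keys_iff)
  then have t: "0 < r e"
    using e by (simp add: r_def N_def divide_pos_neg)
  have nn: "0 \<le> lookup x e' + r e * lookup d e'" for e'
  proof (cases "e' \<in> N")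
    case True
    then have "r e \<le> lookup x e' / - lookup d e'" "0 < - lookup d e'"
      using min[OF True] by (auto simp: r_def N_def)
    then have "r e * - lookup d e' \<le> lookup x e'"
      by (simp only: pos_le_divide_eq)
    then show ?thesis by simp
  next
    case False
    then show ?thesis using t xnn[of e'] by (simp add: N_def)
  qed
  have "keys (x + r e *\<^sub>R d) \<subseteq> E"
    using x d(1) unfolding flow_iff circulation_def subset_iff in_keys_iff lookup_add lookup_scaleR
    by (metis add_0 scaleR_zero_right)
  then have "x + r e *\<^sub>R d \<in> flow_polytope n E b"
    using x d(1) nn by (simp add: flow_iff circulation_def net_add net_scaleR lookup_add)
  moreover have "lookup (x + r e *\<^sub>R d) e = 0"
    unfolding lookup_add lookup_scaleR r_def using e by (simp add: N_def)
  ultimately show thesis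
    using that t e by (auto simp: N_def)
qed

text \<open>A nonzero \<open>z\<close> could be followed from \<open>x\<close> in both directions by
  a positive amount, which would put \<open>x\<close> inside a segment of the polytope. Thus the
  support of a vertex contains no undirected cycle.\<close>

lemma vertex_no_circulation:
  assumes v: "x \<in> polytope_vertices (flow_polytope n E b)"
    and z: "circulation z" "keys z \<subseteq> keys x"
  shows "z = 0"
proof (rule ccontr)
  assume "z \<noteq> 0"
  have x: "x \<in> flow_polytope n E b"
    using v by (simp add: polytope_vertices_def extreme_point_of_def)
  have m: "circulation (- z)"
    using circulation_scaleR[OF z(1), of "-1"] by simp
  have mem: "lookup z e < 0 \<Longrightarrow> e \<in> keys x" "lookup (- z) e < 0 \<Longrightarrow> e \<in> keys x" for e
    using z(2) by (auto simp: in_keys_iff dest!: subsetD[of _ _ e])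
  obtain s where s: "0 < s" "x + s *\<^sub>R z \<in> flow_polytope n E b"
    using ratio_step[OF x z(1) \<open>z \<noteq> 0\<close> mem(1)] by blast
  obtain t where t: "0 < t" "x + t *\<^sub>R (- z) \<in> flow_polytope n E b"
    using ratio_step[OF x m _ mem(2)] \<open>z \<noteq> 0\<close> by (metis neg_equal_0_iff_equal)
  \<comment> \<open>The weight \<open>u\<close> balances the two step lengths, so that the multiples
    of \<open>z\<close> cancel in the convex combination.\<close>
  define u where "u = s / (s + t)"
  have u: "0 < u" "u < 1" "(1 - u) * s = u * t"
    using s t by (auto simp: u_def field_simps)
  have "(1 - u) *\<^sub>R (x + s *\<^sub>R z) + u *\<^sub>R (x + t *\<^sub>R (- z)) = x + ((1 - u) * s - u * t) *\<^sub>R z"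
    by (simp add: algebra_simps)
  also have "\<dots> = x" using u by simp
  finally have eq: "x = (1 - u) *\<^sub>R (x + s *\<^sub>R z) + u *\<^sub>R (x + t *\<^sub>R (- z))" ..
  have "x + s *\<^sub>R z - (x + t *\<^sub>R (- z)) = (s + t) *\<^sub>R z"
    by (simp add: algebra_simps)
  then have "x + s *\<^sub>R z \<noteq> x + t *\<^sub>R (- z)"
    using s t \<open>z \<noteq> 0\<close> by auto
  then have "x \<in> open_segment (x + s *\<^sub>R z) (x + t *\<^sub>R (- z))"
    using eq u by (auto simp: in_segment)
  then show False
    using v s t by (auto simp: polytope_vertices_def extreme_point_of_def)
qed

text \<open>Nonnegative coordinates with positive weights cannot cancel.\<close>

lemma keys_open_segment_flow:
  assumes "a \<in> flow_polytope n E b" "c \<in> flow_polytope n E b" "x \<in> open_segment a c"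
  shows "keys a \<subseteq> keys x" "keys c \<subseteq> keys x"
proof -
  obtain u where u: "0 < u" "u < 1" "x = (1 - u) *\<^sub>R a + u *\<^sub>R c"
    using assms(3) by (auto simp: in_segment)
  have l: "lookup x e = (1 - u) * lookup a e + u * lookup c e" for e
    by (simp add: u lookup_add)
  have nn: "0 \<le> lookup a e" "0 \<le> lookup c e" for e
    using assms flow_nonneg by blast+
  show "keys a \<subseteq> keys x" "keys c \<subseteq> keys x"
    using nn u(1,2) by (auto simp: in_keys_iff l) (smt (verit) mult_nonneg_nonneg mult_pos_pos)+
qed

text \<open>Converse of \<open>vertex_no_circulation\<close>: the ends of a segment through
  \<open>x\<close> differ by a circulation on the support of \<open>x\<close>.\<close>

lemma vertexI:
  assumes x: "x \<in> flow_polytope n E b"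
    and no: "\<And>z. circulation z \<Longrightarrow> keys z \<subseteq> keys x \<Longrightarrow> z = 0"
  shows "x \<in> polytope_vertices (flow_polytope n E b)"
  unfolding polytope_vertices_def extreme_point_of_def
proof (intro CollectI conjI ballI notI x)
  fix a c assume ac: "a \<in> flow_polytope n E b" "c \<in> flow_polytope n E b" "x \<in> open_segment a c"
  have "keys (a - c) \<subseteq> keys x"
    using keys_open_segment_flow[OF ac] keys_diff[of a c] by blast
  then have "a - c = 0"
    using no circulation_diff_flow ac by blast
  then show False using ac(3) by simp
qed

lemma convex_flow: "convex (flow_polytope n E b)"
proof (rule convexI)
  fix x y and u v :: real
  assume a: "x \<in> flow_polytope n E b" "y \<in> flow_polytope n E b" "0 \<le> u" "0 \<le> v" "u + v = 1"
  have "keys (u *\<^sub>R x + v *\<^sub>R y) \<subseteq> E"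
    using a(1,2) unfolding flow_iff subset_iff in_keys_iff lookup_add lookup_scaleR
    by (metis add_0 scaleR_zero_right)
  then show "u *\<^sub>R x + v *\<^sub>R y \<in> flow_polytope n E b"
    using a by (simp add: flow_iff lookup_add net_add net_scaleR flip: distrib_right)
qed

text \<open>The flows supported on \<open>keys x \<union> keys d\<close> form a face, and
  \<open>one\<close> confines it to the line through \<open>x\<close> in direction \<open>d\<close>.
  So it is an edge, and the ratio test finds its other end.\<close>

lemma pivot:
  assumes v: "x \<in> polytope_vertices (flow_polytope n E b)"
    and d: "circulation d" "d \<noteq> 0" and pos: "\<And>e. lookup d e < 0 \<Longrightarrow> e \<in> keys x"
    and one: "\<And>z. circulation z \<Longrightarrow> keys z \<subseteq> keys x \<union> keys d \<Longrightarrow> \<exists>c. z = c *\<^sub>R d"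
  obtains t e where "0 < t" "lookup d e < 0" "lookup (x + t *\<^sub>R d) e = 0"
    "(x, x + t *\<^sub>R d) \<in> polytope_adjacency (flow_polytope n E b)"
proof -
  have x: "x \<in> flow_polytope n E b"
    using v by (simp add: polytope_vertices_def extreme_point_of_def)
  obtain t e where t: "0 < t" "x + t *\<^sub>R d \<in> flow_polytope n E b"
      and e: "lookup d e < 0" "lookup (x + t *\<^sub>R d) e = 0"
    using ratio_step[OF x d pos] by blast
  define y where "y = x + t *\<^sub>R d"
  have keys_y: "keys y \<subseteq> keys x \<union> keys d"
    unfolding y_def by (rule keys_step)
  have vy: "y \<in> polytope_vertices (flow_polytope n E b)"
  proof (rule vertexI)
    show "y \<in> flow_polytope n E b" using t by (simp add: y_def)
    fix z assume z: "circulation z" "keys z \<subseteq> keys y"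
    then obtain c where c: "z = c *\<^sub>R d"
      using one keys_y by blast
    \<comment> \<open>The ratio test empties \<open>e\<close>, so \<open>z\<close> vanishes there
      while \<open>d\<close> does not; this forces the factor \<open>c\<close> to be 0.\<close>
    have "lookup z e = 0"
      using z(2) e(2) unfolding y_def by (metis in_keys_iff subsetD)
    then show "z = 0" using c e(1) by simp
  qed
  \<comment> \<open>At \<open>e'\<close> the vertex \<open>x\<close> is 0 and \<open>d\<close> is
    positive, which stops any movement backwards from \<open>x\<close>; in the same way
    \<open>e\<close> stops the movement beyond \<open>y\<close>.\<close>
  obtain e' where e': "e' \<notin> keys x" "lookup d e' \<noteq> 0"
    using vertex_no_circulation[OF v d(1)] d(2) by (metis in_keys_iff subsetI)
  then have e'_pos: "0 < lookup d e'"
    using pos[of e'] by force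
  have on_segment: "a \<in> closed_segment x y"
    if a: "a \<in> flow_polytope n E b" and ka: "keys a \<subseteq> keys x \<union> keys d" for a
  proof -
    have "keys (a - x) \<subseteq> keys x \<union> keys d"
      using ka keys_diff[of a x] by blast
    then obtain c where "a - x = c *\<^sub>R d"
      using one[OF circulation_diff_flow[OF a x]] by blast
    then have c: "a = x + c *\<^sub>R d" by (simp add: algebra_simps)
    have nn: "0 \<le> lookup a k" for k using a by (rule flow_nonneg)
    have "0 \<le> c * lookup d e'"
      using nn[of e'] e' by (simp add: c lookup_add in_keys_iff)
    then have "0 \<le> c" using e'_pos by (simp add: zero_le_mult_iff)
    have "lookup x e = - t * lookup d e"
      using e(2) by (simp add: lookup_add)
    then have "0 \<le> (c - t) * lookup d e"
      using nn[of e] by (simp add: c lookup_add algebra_simps)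
    then have "c \<le> t" using e(1) by (simp add: zero_le_mult_iff)
    have "a = (1 - c / t) *\<^sub>R x + (c / t) *\<^sub>R y"
      using t(1) by (simp add: c y_def algebra_simps)
    then show ?thesis
      using \<open>0 \<le> c\<close> \<open>c \<le> t\<close> t(1) by (auto simp: in_segment intro!: exI[of _ "c / t"])
  qed
  have "closed_segment x y face_of flow_polytope n E b"
    unfolding face_of_def
  proof (intro conjI ballI impI)
    show "closed_segment x y \<subseteq> flow_polytope n E b"
      using convex_flow x t(2) by (simp add: closed_segment_subset y_def)
    fix a c p assume ac: "a \<in> flow_polytope n E b" "c \<in> flow_polytope n E b"
      and p: "p \<in> closed_segment x y" "p \<in> open_segment a c"
    have "keys p \<subseteq> keys x \<union> keys y"
      using p(1) by (auto simp: in_segment in_keys_iff lookup_add)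
    then have "keys p \<subseteq> keys x \<union> keys d"
      using keys_y by blast
    then show "a \<in> closed_segment x y" "c \<in> closed_segment x y"
      using keys_open_segment_flow[OF ac p(2)] ac on_segment by blast+
  qed simp
  moreover have "x \<noteq> y" using t(1) d(2) by (simp add: y_def)
  ultimately have "(x, y) \<in> polytope_adjacency (flow_polytope n E b)"
    using v vy by (simp add: polytope_adjacency_def)
  then show thesis
    using that t(1) e by (simp add: y_def)
qed

end

section \<open>Clearing the nodes one after the other\<close>

text \<open>Every \<open>x\<close> satisfies \<open>cleared 0\<close>, and a flow with
  \<open>cleared (Suc n)\<close> is supported on the path \<open>n, ..., 1\<close>.\<close>

definition cleared :: "nat \<Rightarrow> (nat \<times> nat \<Rightarrow>\<^sub>0 real) \<Rightarrow> bool" where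
  "cleared i x \<longleftrightarrow> (\<forall>j k. (j, k) \<in> keys x \<longrightarrow> k < i \<longrightarrow> j = Suc k)"

text \<open>Potential that bounds the number of steps spent on node \<open>i\<close>. The extra 1
  pays for a pivot that brings in the path edge without emptying another edge into
  \<open>i\<close>.\<close>

definition unfinished :: "nat \<Rightarrow> (nat \<times> nat \<Rightarrow>\<^sub>0 real) \<Rightarrow> nat" where
  "unfinished i x = card {j. Suc i < j \<and> (j, i) \<in> keys x} + of_bool ((Suc i, i) \<notin> keys x)"

text \<open>Conditions (i) and (iii), the latter shifted by one to avoid subtraction on
  naturals.\<close>

locale intermediate_graph = descending_graph +
  assumes path: "i \<in> {1..<n} \<Longrightarrow> (Suc i, i) \<in> E"
    and interval: "(j, i) \<in> E \<Longrightarrow> Suc i < j \<Longrightarrow> (j, Suc i) \<in> E"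
begin

lemma clearing_step:
  assumes v: "x \<in> polytope_vertices (flow_polytope n E b)"
    and cl: "cleared i x" and j: "Suc i < j" "(j, i) \<in> keys x"
  obtains y where "(x, y) \<in> polytope_adjacency (flow_polytope n E b)"
    "cleared i y" "unfinished i y < unfinished i x"
proof -
  \<comment> \<open>The edge \<open>e\<close> is to be emptied; \<open>f\<close> followed by
    \<open>g\<close> is the detour through \<open>Suc i\<close>.\<close>
  define e f g where efg: "e = (j, i)" "f = (j, Suc i)" "g = (Suc i, i)"
  have x: "x \<in> flow_polytope n E b"
    using v by (simp add: polytope_vertices_def extreme_point_of_def)
  have xnn: "0 \<le> lookup x k" for k using x by (rule flow_nonneg)
  have inE: "e \<in> E" "f \<in> E" "g \<in> E"
  proof -
    show "e \<in> E" using x j by (auto simp: flow_iff efg)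
    then show "f \<in> E" using interval j by (simp add: efg)
    have "i \<in> {1..<n}" using \<open>e \<in> E\<close> nodes j by (auto simp: efg)
    then show "g \<in> E" using path by (simp add: efg)
  qed
  have fin: "finite {j. Suc i < j \<and> (j, i) \<in> keys w}" for w :: "nat \<times> nat \<Rightarrow>\<^sub>0 real"
    by (rule finite_subset[OF _ finite_imageI[OF finite_keys[of w], of fst]]) force
  show thesis
  proof (cases "\<exists>d. circulation d \<and> keys d \<subseteq> insert g (keys x) \<and> d \<noteq> 0")
    case True
    then obtain d0 where d0: "circulation d0" "keys d0 \<subseteq> insert g (keys x)" "d0 \<noteq> 0"
      by blast
    \<comment> \<open>As \<open>x\<close> is a vertex, the circulation must use \<open>g\<close>,
      and \<open>g\<close> carries no flow yet.\<close>
    then have g0: "g \<notin> keys x" "lookup d0 g \<noteq> 0"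
      using vertex_no_circulation[OF v d0(1)] by (blast, metis in_keys_iff subset_insert)
    \<comment> \<open>With coefficient 1 at \<open>g\<close>, the only coordinate that may lie
      outside the support of \<open>x\<close> increases, as the pivot requires.\<close>
    define d where "d = (1 / lookup d0 g) *\<^sub>R d0"
    have d: "circulation d" "keys d \<subseteq> insert g (keys x)" "lookup d g = 1"
    proof -
      show "circulation d" "lookup d g = 1"
        using d0(1) g0(2) circulation_scaleR by (simp_all add: d_def)
      show "keys d \<subseteq> insert g (keys x)"
        using d0(2) keys_step[of 0 "1 / lookup d0 g" d0] by (auto simp: d_def)
    qed
    have pos: "k \<in> keys x" if "lookup d k < 0" for k
    proof -
      have "k \<noteq> g" using that d(3) by auto
      moreover have "k \<in> keys d" using that by (simp add: in_keys_iff)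
      ultimately show ?thesis using d(2) by blast
    qed
    have one: "\<exists>c. z = c *\<^sub>R d" if z: "circulation z" "keys z \<subseteq> keys x \<union> keys d" for z
    proof -
      \<comment> \<open>Cancelling the coordinate at \<open>g\<close> leaves a circulation on the
        support of the vertex \<open>x\<close>, which must be 0.\<close>
      have "keys (z - lookup z g *\<^sub>R d) \<subseteq> keys x"
      proof
        fix k assume k: "k \<in> keys (z - lookup z g *\<^sub>R d)"
        then have "k \<noteq> g" using d(3) by (auto simp: in_keys_iff lookup_minus)
        moreover have "k \<in> keys z \<union> keys d"
          using k by (auto simp: in_keys_iff lookup_minus)
        ultimately show "k \<in> keys x"
          using z(2) d(2) by blast
      qed
      then have "z - lookup z g *\<^sub>R d = 0"
        using vertex_no_circulation[OF v] circulation_diff circulation_scaleR z(1) d(1) by blast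
      then show ?thesis by auto
    qed
    obtain t where t: "0 < t" "(x, x + t *\<^sub>R d) \<in> polytope_adjacency (flow_polytope n E b)"
      by (rule pivot[OF v d(1) _ pos one]) (use d(3) in auto)
    define y where "y = x + t *\<^sub>R d"
    have ky: "keys y \<subseteq> insert g (keys x)"
      using d(2) keys_step[of x t d] unfolding y_def by blast
    have gy: "g \<in> keys y"
      using g0 d(3) t(1) by (simp add: y_def in_keys_iff lookup_add)
    have "cleared i y"
      using cl ky by (auto simp: cleared_def efg)
    \<comment> \<open>Only \<open>g\<close> can enter the support, and it is not counted here; its
      entry removes the extra 1 in \<open>unfinished\<close>.\<close>
    moreover have "card {j. Suc i < j \<and> (j, i) \<in> keys y} \<le> card {j. Suc i < j \<and> (j, i) \<in> keys x}"
      by (rule card_mono[OF fin]) (use ky in \<open>auto simp: efg\<close>)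
    then have "unfinished i y < unfinished i x"
      using g0 gy by (simp add: unfinished_def efg)
    ultimately show thesis using that t(2) by (simp add: y_def)
  next
    case False
    define d :: "nat \<times> nat \<Rightarrow>\<^sub>0 real" where
      "d = Poly_Mapping.single f 1 + Poly_Mapping.single g 1 - Poly_Mapping.single e 1"
    have neq: "e \<noteq> f" "e \<noteq> g" "f \<noteq> g"
      using j by (auto simp: efg)
    have ld: "lookup d e = - 1" "lookup d f = 1" "lookup d g = 1"
      using neq by (auto simp: d_def lookup_add lookup_minus lookup_single)
    have ld0: "lookup d k = 0" if "k \<noteq> e" "k \<noteq> f" "k \<noteq> g" for k
      using that by (auto simp: d_def lookup_add lookup_minus lookup_single)
    have kd: "keys d \<subseteq> {e, f, g}"
      using ld0 by (auto simp: in_keys_iff)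
    have "circulation d"
      using kd inE by (auto simp: circulation_def d_def net_add net_diff net_single) (auto simp: efg)
    have pos: "k \<in> keys x" if "lookup d k < 0" for k
      using ld ld0[of k] that j by (cases "k = e"; cases "k = f"; cases "k = g") (auto simp: efg)
    have ke: "e \<in> keys x" using j by (simp add: efg)
    have one: "\<exists>c. z = c *\<^sub>R d" if z: "circulation z" "keys z \<subseteq> keys x \<union> keys d" for z
    proof -
      \<comment> \<open>Now the coordinate at \<open>f\<close> is cancelled. What remains is a
        circulation on the support enlarged by \<open>g\<close>, and the case assumption makes it
        0.\<close>
      have "keys (z - lookup z f *\<^sub>R d) \<subseteq> insert g (keys x)"
      proof
        fix k assume k: "k \<in> keys (z - lookup z f *\<^sub>R d)"
        then have "k \<noteq> f" using ld by (auto simp: in_keys_iff lookup_minus)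
        moreover have "k \<in> keys z \<union> keys d"
          using k by (auto simp: in_keys_iff lookup_minus)
        ultimately show "k \<in> insert g (keys x)"
          using z(2) kd ke by blast
      qed
      then have "z - lookup z f *\<^sub>R d = 0"
        using False circulation_diff circulation_scaleR z(1) \<open>circulation d\<close> by blast
      then show ?thesis by auto
    qed
    obtain t k where t: "0 < t" "lookup d k < 0" "lookup (x + t *\<^sub>R d) k = 0"
        "(x, x + t *\<^sub>R d) \<in> polytope_adjacency (flow_polytope n E b)"
      by (rule pivot[OF v \<open>circulation d\<close> _ pos one]) (use ld in auto)
    \<comment> \<open>Only \<open>e\<close> decreases along \<open>d\<close>, so it is the edge that
      the pivot empties.\<close>
    have "k = e"
      using t(2) ld ld0[of k] by (cases "k = f"; cases "k = g") auto
    define y where "y = x + t *\<^sub>R d"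
    have ey: "e \<notin> keys y"
      using t(3) \<open>k = e\<close> by (simp add: y_def in_keys_iff)
    have ky: "keys y \<subseteq> insert f (insert g (keys x))"
      using kd ke keys_step[of x t d] unfolding y_def by blast
    have gy: "g \<in> keys y"
      using ld xnn[of g] t(1) by (simp add: y_def in_keys_iff lookup_add)
    \<comment> \<open>The edges \<open>f\<close> and \<open>g\<close> end at \<open>Suc i\<close>
      and \<open>i\<close>, so nothing new ends at a node below \<open>i\<close>.\<close>
    have "cleared i y"
      using cl ky by (auto simp: cleared_def efg)
    moreover have "card {j. Suc i < j \<and> (j, i) \<in> keys y} < card {j. Suc i < j \<and> (j, i) \<in> keys x}"
    proof (rule psubset_card_mono[OF fin])
      have "{j. Suc i < j \<and> (j, i) \<in> keys y} \<subseteq> {j. Suc i < j \<and> (j, i) \<in> keys x}"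
        using ky by (auto simp: efg)
      then show "{j. Suc i < j \<and> (j, i) \<in> keys y} \<subset> {j. Suc i < j \<and> (j, i) \<in> keys x}"
        using ey j by (auto simp: efg)
    qed
    then have "unfinished i y < unfinished i x"
      using gy by (simp add: unfinished_def efg)
    ultimately show thesis using that t(4) by (simp add: y_def)
  qed
qed

text \<open>Each step along an edge of the polytope lowers \<open>unfinished i\<close>. When no step
  is left to do, flow into \<open>i\<close> can only come from \<open>Suc i\<close>, since edges
  descend.\<close>

lemma clear_node_unfinished:
  assumes "x \<in> polytope_vertices (flow_polytope n E b)" "cleared i x"
  shows "\<exists>y k. (x, y) \<in> polytope_adjacency (flow_polytope n E b) ^^ k \<and> k \<le> unfinished i x \<and>
    y \<in> polytope_vertices (flow_polytope n E b) \<and> cleared (Suc i) y"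
  using assms
proof (induction "unfinished i x" arbitrary: x rule: less_induct)
  case less
  show ?case
  proof (cases "\<exists>j. Suc i < j \<and> (j, i) \<in> keys x")
    case True
    then obtain j where j: "Suc i < j" "(j, i) \<in> keys x" by blast
    obtain y where y: "(x, y) \<in> polytope_adjacency (flow_polytope n E b)" "cleared i y"
        "unfinished i y < unfinished i x"
      using clearing_step[OF less.prems j] by blast
    then have "y \<in> polytope_vertices (flow_polytope n E b)"
      by (simp add: polytope_adjacency_def)
    from less.hyps[OF y(3) this y(2)] obtain z k where
      z: "(y, z) \<in> polytope_adjacency (flow_polytope n E b) ^^ k" "k \<le> unfinished i y"
        "z \<in> polytope_vertices (flow_polytope n E b)" "cleared (Suc i) z" by blast
    have "(x, z) \<in> polytope_adjacency (flow_polytope n E b) ^^ Suc k"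
      using y(1) z(1) by (rule relpow_Suc_I2)
    then show ?thesis using y(3) z(2-)
      by (intro exI[of _ z] exI[of _ "Suc k"]) simp
  next
    case False
    have "keys x \<subseteq> E"
      using less.prems by (auto simp: polytope_vertices_def extreme_point_of_def flow_iff)
    then have "j = Suc i" if "(j, i) \<in> keys x" for j
      using False descending[of j i] that by (metis Suc_lessI subsetD)
    then have "cleared (Suc i) x"
      using less.prems(2) by (auto simp: cleared_def less_Suc_eq)
    then show ?thesis using less.prems(1) by (intro exI[of _ x] exI[of _ 0]) auto
  qed
qed

lemma clear_node:
  assumes v: "x \<in> polytope_vertices (flow_polytope n E b)" and cl: "cleared i x"
  shows "\<exists>y k. (x, y) \<in> polytope_adjacency (flow_polytope n E b) ^^ k \<and> k \<le> card {e \<in> E. snd e = i} \<and>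
    y \<in> polytope_vertices (flow_polytope n E b) \<and> cleared (Suc i) y"
\<comment> \<open>A node that is already cleared is treated apart: at \<open>i = n\<close> no edge
  enters \<open>i\<close>, yet \<open>unfinished\<close> is 1. Otherwise some
  \<open>j > Suc i\<close> sends flow to \<open>i\<close>, so the path edge into \<open>i\<close>
  exists and accounts for the extra 1.\<close>
proof (cases "cleared (Suc i) x")
  case True
  then show ?thesis using v by (intro exI[of _ x] exI[of _ 0]) auto
next
  case False
  have kE: "keys x \<subseteq> E"
    using v by (auto simp: polytope_vertices_def extreme_point_of_def flow_iff)
  obtain j where j: "(j, i) \<in> keys x" "j \<noteq> Suc i"
    using False cl by (auto simp: cleared_def less_Suc_eq)
  then have "Suc i < j"
    using kE descending[of j i] by force
  then have "(Suc i, i) \<in> E"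
    using j kE nodes by (intro path) auto
  define A where "A = {j. Suc i < j \<and> (j, i) \<in> keys x}"
  have "finite A"
    unfolding A_def
    by (rule finite_subset[OF _ finite_imageI[OF finite_keys[of x], of fst]]) force
  then have "card A + 1 = card ((\<lambda>j. (j, i)) ` insert (Suc i) A)"
    by (subst card_image) (auto simp: inj_on_def A_def)
  also have "\<dots> \<le> card {e \<in> E. snd e = i}"
    using kE \<open>(Suc i, i) \<in> E\<close> finite_E by (intro card_mono) (auto simp: A_def)
  finally have "unfinished i x \<le> card {e \<in> E. snd e = i}"
    by (simp add: unfinished_def A_def)
  then show ?thesis
    using clear_node_unfinished[OF v cl] le_trans by blast
qed

section \<open>Clearing all nodes, and the common end of all walks\<close>

lemma clear_nodes:
  assumes "x \<in> polytope_vertices (flow_polytope n E b)"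
  shows "\<exists>y k. (x, y) \<in> polytope_adjacency (flow_polytope n E b) ^^ k \<and> k \<le> card {e \<in> E. snd e < i} \<and>
    y \<in> polytope_vertices (flow_polytope n E b) \<and> cleared i y"
proof (induction i)
  case 0
  show ?case using assms by (intro exI[of _ x] exI[of _ 0]) (auto simp: cleared_def)
next
  case (Suc i)
  obtain y k where y: "(x, y) \<in> polytope_adjacency (flow_polytope n E b) ^^ k"
      "k \<le> card {e \<in> E. snd e < i}" "y \<in> polytope_vertices (flow_polytope n E b)" "cleared i y"
    using Suc by blast
  obtain z l where z: "(y, z) \<in> polytope_adjacency (flow_polytope n E b) ^^ l"
      "l \<le> card {e \<in> E. snd e = i}" "z \<in> polytope_vertices (flow_polytope n E b)" "cleared (Suc i) z"
    using clear_node[OF y(3,4)] by blast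
  have "(x, z) \<in> polytope_adjacency (flow_polytope n E b) ^^ (k + l)"
    using y(1) z(1) by (auto simp: relpow_add)
  moreover have "{e \<in> E. snd e < Suc i} = {e \<in> E. snd e < i} \<union> {e \<in> E. snd e = i}"
    by auto
  then have "card {e \<in> E. snd e < Suc i} = card {e \<in> E. snd e < i} + card {e \<in> E. snd e = i}"
    using finite_E by (simp add: card_Un_disjoint disjoint_iff)
  ultimately show ?case
    using y(2) z(2-) by (intro exI[of _ z] exI[of _ "k + l"]) simp
qed

text \<open>The difference of the two flows lives on the path. Conservation equates its values on
  the two path edges at a node, so the value 0 spreads upwards from node 1.\<close>

lemma cleared_unique:
  assumes x: "x \<in> flow_polytope n E b" "cleared (Suc n) x"
    and y: "y \<in> flow_polytope n E b" "cleared (Suc n) y"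
  shows "x = y"
proof -
  define z where "z = x - y"
  have z: "circulation z"
    using circulation_diff_flow x y by (simp add: z_def)
  have kz: "j = Suc i \<and> (j, i) \<in> E" if "(j, i) \<in> keys z" for j i
  proof -
    have "(j, i) \<in> keys x \<union> keys y"
      using that keys_diff[of x y] by (auto simp: z_def)
    moreover have "keys x \<union> keys y \<subseteq> E"
      using x y by (simp add: flow_iff)
    ultimately have "(j, i) \<in> E" by blast
    moreover from this have "i < Suc n" using nodes by auto
    ultimately show ?thesis
      using \<open>(j, i) \<in> keys x \<union> keys y\<close> x(2) y(2) by (auto simp: cleared_def)
  qed
  have "lookup z (Suc i, i) = 0" for i
  proof (induction i)
    case 0
    \<comment> \<open>The induction starts at the nonexistent node 0: node 1 has no outflow.\<close>
    have "(Suc 0, 0) \<notin> E" using nodes by auto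
    then show ?case using kz[of "Suc 0" 0] by (auto simp: in_keys_iff)
  next
    case (Suc i)
    show ?case
    proof (cases "(Suc (Suc i), Suc i) \<in> E")
      case True
      have "lookup z (Suc i, j) = 0" for j
        using kz[of "Suc i" j] Suc by (cases "j = i") (auto simp: in_keys_iff)
      \<comment> \<open>Only the path edge contributes to the inflow, so the vanishing outflow
        forces its value to be 0.\<close>
      moreover have "(\<Sum>j | (j, Suc i) \<in> E. lookup z (j, Suc i)) = (\<Sum>j\<in>{Suc (Suc i)}. lookup z (j, Suc i))"
      proof (rule sum.mono_neutral_right)
        show "finite {j. (j, Suc i) \<in> E}"
          by (rule finite_subset[of _ "{1..n}"]) (use nodes in auto)
      qed (use True kz[of _ "Suc i"] in \<open>auto simp: in_keys_iff\<close>)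
      moreover have "net z (Suc i) = 0"
        using z True nodes by (auto simp: circulation_def)
      ultimately show ?thesis
        by (simp flip: net_eq)
    next
      case False
      then show ?thesis using kz by (auto simp: in_keys_iff)
    qed
  qed
  then have "lookup z e = 0" for e
    using kz[of "fst e" "snd e"] by (cases e) (auto simp: in_keys_iff)
  then have "z = 0" by (simp add: poly_mapping_eqI)
  then show ?thesis by (simp add: z_def)
qed

text \<open>Both vertices lead to the same cleared vertex, each within \<open>card E\<close> steps;
  adjacency is symmetric, so the second walk can be reversed.\<close>

lemma vertices_joined:
  assumes u: "u \<in> polytope_vertices (flow_polytope n E b)"
    and v: "v \<in> polytope_vertices (flow_polytope n E b)"
  shows "\<exists>k \<le> 2 * card E. (u, v) \<in> polytope_adjacency (flow_polytope n E b) ^^ k"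
proof -
  let ?R = "polytope_adjacency (flow_polytope n E b)"
  have le: "card {e \<in> E. snd e < Suc n} \<le> card E"
    using finite_E by (intro card_mono) auto
  obtain w k where w: "(u, w) \<in> ?R ^^ k" "k \<le> card E"
      "w \<in> polytope_vertices (flow_polytope n E b)" "cleared (Suc n) w"
    using clear_nodes[OF u, of "Suc n"] le le_trans by blast
  obtain w' l where w': "(v, w') \<in> ?R ^^ l" "l \<le> card E"
      "w' \<in> polytope_vertices (flow_polytope n E b)" "cleared (Suc n) w'"
    using clear_nodes[OF v, of "Suc n"] le le_trans by blast
  have "w' = w"
    using w w' by (intro cleared_unique) (auto simp: polytope_vertices_def extreme_point_of_def)
  have "sym ?R"
    by (auto simp: sym_def polytope_adjacency_def closed_segment_commute)
  then have "(w, v) \<in> ?R ^^ l"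
    using w'(1) \<open>w' = w\<close> by (blast intro: relpow_sym)
  then have "(u, v) \<in> ?R ^^ (k + l)"
    using w(1) by (auto simp: relpow_add)
  then show ?thesis using w(2) w'(2) by (intro exI[of _ "k + l"]) simp
qed

end

section \<open>From the intermediate property to the diameter\<close>

lemma intermediate_graphI:
  assumes dag: "dag_on n E" and ip: "intermediate_property n E"
  shows "intermediate_graph n E"
proof
  show nodes: "E \<subseteq> {1..n} \<times> {1..n}"
    using dag by (simp add: dag_on_def)
  show desc: "i < j" if "(j, i) \<in> E" for j i
  proof (rule ccontr)
    assume "\<not> i < j"
    \<comment> \<open>An edge from \<open>j\<close> to some \<open>i \<ge> j\<close> survives the
      deletion of the nodes below \<open>j\<close>, so \<open>j\<close> would not be a sink
      there.\<close>
    then have "(j, i) \<in> remove_nodes E {1..<j}"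
      using that by (auto simp: remove_nodes_def)
    moreover have "j \<in> {1..n}" using that nodes by auto
    ultimately show False
      using ip by (auto simp: intermediate_property_def is_sink_def)
  qed
  show "(Suc i, i) \<in> E" if "i \<in> {1..<n}" for i
    using ip that by (auto simp: intermediate_property_def)
  show "(j, Suc i) \<in> E" if "(j, i) \<in> E" "Suc i < j" for j i
  proof -
    have "Suc i \<in> {1..n}" "j \<in> {1..n}"
      using that nodes by auto
    then show ?thesis
      using ip that by (auto simp: intermediate_property_def)
  qed
qed

theorem theorem3p35:
  fixes n m :: nat and E :: "(nat \<times> nat) set" and b :: "nat \<Rightarrow> real"
  assumes "dag_on n E" and "card E = m" and "intermediate_property n E"
  shows "polytope_diameter (flow_polytope n E b) \<le> enat (2 * m)"
proof -
  interpret intermediate_graph n E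
    using intermediate_graphI assms by blast
  show ?thesis
    unfolding polytope_diameter_def graph_diameter_def
  proof (intro SUP_least)
    fix u v assume "u \<in> polytope_vertices (flow_polytope n E b)"
      "v \<in> polytope_vertices (flow_polytope n E b)"
    then obtain k where k: "k \<le> 2 * m" "(u, v) \<in> polytope_adjacency (flow_polytope n E b) ^^ k"
      using vertices_joined assms(2) by blast
    \<comment> \<open>The distance is an infimum over lengths of walks, so the walk found bounds it
      and makes it finite.\<close>
    have "graph_distance (polytope_adjacency (flow_polytope n E b)) u v \<le> enat k"
      unfolding graph_distance_def using k(2) by (intro INF_lower) simp
    also have "\<dots> \<le> enat (2 * m)" using k(1) by simp
    finally show "graph_distance (polytope_adjacency (flow_polytope n E b)) u v \<le> enat (2 * m)" .
  qed
qed

end
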